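(* For any $X\neq Y$ in $\{rv\Delta,\ vr\Delta,\ rv\Delta',\ vr\Delta'\}$, a $Y$-move is realized by a combination of (i.e. a finite sequence of) $X$-moves and generalized Reidemeister moves.
   Context: A virtual link diagram is a generic immersion of finitely many oriented circles in the plane in which each double point is either a real crossing (with over/under information) or a virtual crossing. Generalized Reidemeister moves are the classical Reidemeister moves I, II, III together with the virtual moves involving virtual crossings; they may be used in both directions. Consider a disk in which three strands (with arbitrary orientations, belonging to arbitrary components) pairwise cross exactly once, forming a triangle. If the three crossings are real and each strand passes over one of the other two strands and under the other one, the crossings are alternating, and there are two such patterns, mirror images of each other, obtained from one another by changing all three crossings: in one of them every side of the triangle, traversed counterclockwise around the triangle, goes from an under-crossing to an over-crossing; in the other it goes from an over-crossing to an under-crossing. Call one of these two patterns $\Delta$ and the other $\Delta'$ (which one is named $\Delta$ is immaterial). The four moves below are one-directional: - an $rv\Delta$-move replaces the three real crossings of a pattern $\Delta$ by three virtual crossings; - a $vr\Delta$-move replaces three virtual crossings of a triangle by three real crossings forming the pattern $\Delta$; - an $rv\Delta'$-move replaces the three real crossings of a pattern $\Delta'$ by three virtual crossings; - a $vr\Delta'$-move replaces three virtual crossings of a triangle by three real crossings forming the pattern $\Delta'$. In "realized by $X$-moves", only $X$-moves in their stated direction may be used, not their inverses. *)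

theory Defs
  imports Main
begin

section \<open>Virtual link diagrams\<close>

text \<open>
  The library has no generic immersions of circles. A diagram is given here by the usual
  combinatorial description of a generic immersion of oriented circles in the plane: the immersion
  is put in general position with respect to the height function, so that its crossings, local
  minima and local maxima lie at pairwise different heights, and it is then read from bottom to
  top. It becomes the word of these singular levels. Each letter records the kind of the level and
  the number of strands to the left of it. Every generic immersion can be put in this form by
  a planar isotopy, and two words present planar isotopic immersions iff they are related by the
  moves listed in the rules of planar isotopy below.

  Near a crossing both branches are monotone in the height. The branch \<open>Slash\<close> runs
  between bottom left and top right, the branch \<open>Backslash\<close> between bottom right and
  top left; this says nothing about the orientation of the strands. \<open>Real s\<close> is a real crossing
  at which the branch \<open>s\<close> is the upper one.
\<close>

datatype branch = Slash | Backslash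

fun other :: "branch \<Rightarrow> branch" where
  "other Slash = Backslash"
| "other Backslash = Slash"

datatype crossing = Real branch | Virtual

fun over :: "crossing \<Rightarrow> branch \<Rightarrow> bool" where
  "over (Real s) t \<longleftrightarrow> t = s"
| "over Virtual t \<longleftrightarrow> False"

fun under :: "crossing \<Rightarrow> branch \<Rightarrow> bool" where
  "under (Real s) t \<longleftrightarrow> t \<noteq> s"
| "under Virtual t \<longleftrightarrow> False"

datatype direction = Up | Down

fun opposite :: "direction \<Rightarrow> direction" where
  "opposite Up = Down"
| "opposite Down = Up"

text \<open>
  \<open>Cup d\<close> is a local minimum whose left leg is directed \<open>d\<close>; \<open>Cap\<close> is a local maximum, which takes
  its orientation from the strands that it joins.
\<close>

datatype piece = Cup direction | Cap | Cross crossing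

type_synonym level = "nat \<times> piece"
type_synonym diagram = "level list"

text \<open>
  \<open>slice xs e ys\<close>: the level \<open>e\<close> leads from the list of directions \<open>xs\<close> of the strands just
  below it (from left to right) to the list \<open>ys\<close> just above it.
\<close>

inductive slice :: "direction list \<Rightarrow> level \<Rightarrow> direction list \<Rightarrow> bool" where
  cup: "slice (xs @ ys) (length xs, Cup d) (xs @ [d, opposite d] @ ys)"
| cap: "slice (xs @ [d, opposite d] @ ys) (length xs, Cap) (xs @ ys)"
| cross: "slice (xs @ [d, e] @ ys) (length xs, Cross c) (xs @ [e, d] @ ys)"

inductive tangle :: "direction list \<Rightarrow> level list \<Rightarrow> direction list \<Rightarrow> bool" where
  Nil: "tangle xs [] xs"
| Cons: "slice xs e ys \<Longrightarrow> tangle ys w zs \<Longrightarrow> tangle xs (e # w) zs"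

definition virtual_link_diagram :: "diagram \<Rightarrow> bool" where
  "virtual_link_diagram D \<longleftrightarrow> tangle [] D []"


section \<open>Local replacements and planar isotopy\<close>

text \<open>
  A rule \<open>R l r\<close> replaces the part \<open>l\<close> of a diagram lying in a disk by \<open>r\<close>. Rules need not mention
  the strands that they run through (for instance those crossing twice in a second
  Reidemeister move), since both sides are required to be diagrams.
\<close>

definition replacement :: "(level list \<Rightarrow> level list \<Rightarrow> bool) \<Rightarrow> diagram \<Rightarrow> diagram \<Rightarrow> bool" where
  "replacement R D D' \<longleftrightarrow> virtual_link_diagram D \<and> virtual_link_diagram D' \<and>
     (\<exists>u v l r. R l r \<and> D = u @ l @ v \<and> D' = u @ r @ v)"

fun inputs :: "piece \<Rightarrow> nat" where
  "inputs (Cup d) = 0"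
| "inputs Cap = 2"
| "inputs (Cross c) = 2"

fun outputs :: "piece \<Rightarrow> nat" where
  "outputs (Cup d) = 2"
| "outputs Cap = 0"
| "outputs (Cross c) = 2"

text \<open>The same crossing, with the names of its two branches interchanged.\<close>

fun swap :: "crossing \<Rightarrow> crossing" where
  "swap (Real s) = Real (other s)"
| "swap Virtual = Virtual"

text \<open>
  The codimension one events of a generic planar isotopy: two singular levels exchange their
  heights; a minimum and a maximum of a strand cancel; a minimum or a maximum of
  one branch passes through a crossing, which thereby moves from one leg to the other.
\<close>

inductive isotopy_rule :: "level list \<Rightarrow> level list \<Rightarrow> bool" where
  exchange:
    "isotopy_rule [(i, p), (i + outputs p + k, q)] [(i + inputs p + k, q), (i, p)]"
| straighten_S: "isotopy_rule [(Suc i, Cup d), (i, Cap)] []"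
| straighten_Z: "isotopy_rule [(i, Cup d), (Suc i, Cap)] []"
| cup_crossing:
    "isotopy_rule [(i, Cup d), (Suc i, Cross c)] [(Suc i, Cup d), (i, Cross (swap c))]"
| cap_crossing:
    "isotopy_rule [(Suc i, Cross c), (i, Cap)] [(i, Cross (swap c)), (Suc i, Cap)]"

definition planar_isotopic :: "diagram \<Rightarrow> diagram \<Rightarrow> bool" where
  "planar_isotopic = (sup (replacement isotopy_rule) (replacement isotopy_rule)\<inverse>\<inverse>)\<^sup>*\<^sup>*"

text \<open>A move may be performed in any disk that some planar isotopy brings to the form of the rule.\<close>

definition local_move :: "(level list \<Rightarrow> level list \<Rightarrow> bool) \<Rightarrow> diagram \<Rightarrow> diagram \<Rightarrow> bool" where
  "local_move R = planar_isotopic OO replacement R OO planar_isotopic"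


section \<open>Generalized Reidemeister moves\<close>

text \<open>
  In \<open>triangle i j a b c\<close> with \<open>j = Suc i\<close> or \<open>i = Suc j\<close> three strands cross pairwise
  exactly once: for \<open>p\<close>, \<open>q\<close>, \<open>r\<close> from left to right at the bottom, the crossings are
  \<open>pq\<close>, \<open>pr\<close>, \<open>qr\<close> from bottom to top if \<open>j = Suc i\<close>, and \<open>qr\<close>, \<open>pr\<close>, \<open>pq\<close> if \<open>i = Suc j\<close>. The
  left one of the two strands is always the \<open>Slash\<close> branch.
\<close>

definition triangle :: "nat \<Rightarrow> nat \<Rightarrow> crossing \<Rightarrow> crossing \<Rightarrow> crossing \<Rightarrow> level list" where
  "triangle i j a b c = [(i, Cross a), (j, Cross b), (i, Cross c)]"

text \<open>
  The triples \<open>pq\<close>, \<open>pr\<close>, \<open>qr\<close> of crossings allowed in a third move. In the case \<open>classical\<close> the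
  condition says that the three strands lie at three levels above one another, i.e. that the
  triangle is not alternating. In the mixed cases a strand with two virtual crossings passes a
  real crossing; the forbidden moves, with exactly two real crossings, are not included.
\<close>

inductive third_move_crossings :: "crossing \<Rightarrow> crossing \<Rightarrow> crossing \<Rightarrow> bool" where
  classical: "t = s \<or> t = u \<Longrightarrow> third_move_crossings (Real s) (Real t) (Real u)"
| "virtual": "third_move_crossings Virtual Virtual Virtual"
| mixed_pq: "third_move_crossings (Real s) Virtual Virtual"
| mixed_pr: "third_move_crossings Virtual (Real s) Virtual"
| mixed_qr: "third_move_crossings Virtual Virtual (Real s)"

text \<open>The crossing \<open>c\<close> may be virtual in the first two moves, which gives the virtual moves I and II.\<close>

inductive reidemeister_rule :: "level list \<Rightarrow> level list \<Rightarrow> bool" where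
  I_left: "reidemeister_rule [(i, Cup d), (Suc i, Cross c), (i, Cap)] []"
| I_right: "reidemeister_rule [(Suc i, Cup d), (i, Cross c), (Suc i, Cap)] []"
| II: "reidemeister_rule [(i, Cross c), (i, Cross (swap c))] []"
| III: "third_move_crossings a b c \<Longrightarrow>
    reidemeister_rule (triangle i (Suc i) a b c) (triangle (Suc i) i c b a)"

definition generalized_reidemeister_move :: "diagram \<Rightarrow> diagram \<Rightarrow> bool" where
  "generalized_reidemeister_move =
     sup (local_move reidemeister_rule) (local_move reidemeister_rule)\<inverse>\<inverse>"


section \<open>Moves on alternating triangles\<close>

text \<open>
  The sides of the triangle of \<open>triangle i j a b c\<close>, traversed counterclockwise. A side is given by
  its initial and its final vertex, each together with the branch on which the side lies there.
  The vertices are \<open>a\<close> at the bottom, \<open>c\<close> at the top, and \<open>b\<close> to the right of them if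
  \<open>j = Suc i\<close> and to the left of them if \<open>i = Suc j\<close>.
\<close>

definition counterclockwise_sides ::
  "nat \<Rightarrow> nat \<Rightarrow> crossing \<Rightarrow> crossing \<Rightarrow> crossing \<Rightarrow>
   ((crossing \<times> branch) \<times> (crossing \<times> branch)) set" where
  "counterclockwise_sides i j a b c =
     (if j = Suc i
      then {((a, Slash), (b, Slash)), ((b, Backslash), (c, Backslash)), ((c, Slash), (a, Backslash))}
      else {((a, Slash), (c, Backslash)), ((c, Slash), (b, Slash)), ((b, Backslash), (a, Backslash))})"

inductive Delta :: "level list \<Rightarrow> level list \<Rightarrow> bool" where
  "j = Suc i \<or> i = Suc j \<Longrightarrow>
   (\<forall>((x, s), (y, t)) \<in> counterclockwise_sides i j a b c. under x s \<and> over y t) \<Longrightarrow>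
   Delta (triangle i j a b c) (triangle i j Virtual Virtual Virtual)"

inductive Delta' :: "level list \<Rightarrow> level list \<Rightarrow> bool" where
  "j = Suc i \<or> i = Suc j \<Longrightarrow>
   (\<forall>((x, s), (y, t)) \<in> counterclockwise_sides i j a b c. over x s \<and> under y t) \<Longrightarrow>
   Delta' (triangle i j a b c) (triangle i j Virtual Virtual Virtual)"

datatype move_type = rv_Delta | vr_Delta | rv_Delta' | vr_Delta'

fun move_rule :: "move_type \<Rightarrow> level list \<Rightarrow> level list \<Rightarrow> bool" where
  "move_rule rv_Delta = Delta"
| "move_rule vr_Delta = Delta\<inverse>\<inverse>"
| "move_rule rv_Delta' = Delta'"
| "move_rule vr_Delta' = Delta'\<inverse>\<inverse>"

definition delta_move :: "move_type \<Rightarrow> diagram \<Rightarrow> diagram \<Rightarrow> bool" where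
  "delta_move X = local_move (move_rule X)"

definition realized_by :: "move_type \<Rightarrow> diagram \<Rightarrow> diagram \<Rightarrow> bool" where
  "realized_by X =
     (sup (delta_move X) (sup generalized_reidemeister_move planar_isotopic))\<^sup>*\<^sup>*"

end

theory Submission
  imports Defs
begin

text \<open>
  All arguments take place in a disk, where the words of levels behave like elements of a group:
  write \<open>c\<^sub>i\<close> for a real crossing at position \<open>i\<close>, \<open>c'\<^sub>i\<close> for its inverse, i.e. the crossing
  with the other branch on top, and \<open>v\<^sub>i\<close> for a virtual crossing, which is its own inverse. The
  second and third moves make the words of crossings a virtual braid group. For adjacent
  positions \<open>i\<close> and \<open>j\<close> the two alternating triangles are \<open>c\<^sub>i c'\<^sub>j c\<^sub>i\<close> and \<open>c'\<^sub>i c\<^sub>j c'\<^sub>i\<close>; they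
  are inverse to each other, and the virtual triangle \<open>T = v\<^sub>i v\<^sub>j v\<^sub>i = v\<^sub>j v\<^sub>i v\<^sub>j\<close> is an
  involution. The rules for crossings do not mention orientations, so that one calculation covers
  all of them.

  Suppose that a move \<open>X\<close> turns \<open>A = c\<^sub>i c'\<^sub>j c\<^sub>i\<close> into \<open>T\<close>. Then \<open>T = A\<^sup>-\<^sup>1 A T\<close> becomes
  \<open>A\<^sup>-\<^sup>1 T T = A\<^sup>-\<^sup>1\<close>, so that \<open>X\<close> realizes the insertion of the mirror image of \<open>A\<close>; likewise in
  the other direction (lemmas \<open>adds_swap_if_removes\<close> and \<open>removes_swap_if_adds\<close>). This pairs
  removing one pattern with inserting the other. It remains to connect the two pairs, that is, to
  insert \<open>c'\<^sub>i c\<^sub>j c'\<^sub>i\<close> when the insertion of \<open>c\<^sub>i c'\<^sub>j c\<^sub>i\<close> is given, and this is the heart of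
  the proof (lemma \<open>adds_swap_if_adds\<close>).

  It cannot be done with braids alone. If all strands run upwards and \<open>c\<close> is positive, then each
  insertion of \<open>c\<^sub>i c'\<^sub>j c\<^sub>i\<close> raises the writhe by \<open>1\<close>, while \<open>c'\<^sub>i c\<^sub>j c'\<^sub>i\<close> has writhe \<open>-1\<close>. One
  has to turn strands around. First, two insertions, made in such places that most crossings
  cancel, put \<open>c\<^sub>j v\<^sub>j c\<^sub>j v\<^sub>j\<close> into two adjacent strands
  (lemma \<open>crossing_square_inserted\<close>). Next, a crossing \<open>c\<close> turned by a quarter of a full turn is a
  crossing \<open>c'\<close>. Inserting the square next to this \<open>c'\<close> leaves \<open>v c v\<close>; turned back, this is
  \<open>v c' v\<close>. Hence \<open>c\<close> can be replaced by \<open>v c' v\<close> (lemma \<open>crossing_to_flanked\<close>), and conversely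
  \<open>v c' v\<close> by \<open>c\<close>. Finally \<open>T\<close> becomes \<open>T c\<^sub>j c'\<^sub>i c\<^sub>j T\<close> by an insertion; conjugation by \<open>T\<close> takes
  \<open>c\<^sub>j\<close> to \<open>v\<^sub>i c\<^sub>i v\<^sub>i\<close> and \<open>c'\<^sub>i\<close> to \<open>v\<^sub>j c'\<^sub>j v\<^sub>j\<close>, and the replacements turn this into
  \<open>c'\<^sub>i c\<^sub>j c'\<^sub>i\<close>.
\<close>

section \<open>The strands above a word of levels\<close>

text \<open>
  A level determines the strands above it from those below it. As a function, the relation
  \<^const>\<open>tangle\<close> can be decided by rewriting on explicit words.
\<close>

fun run_level :: "direction list \<Rightarrow> level \<Rightarrow> direction list option" where
  "run_level xs (i, Cup d) =
    (if i \<le> length xs then Some (take i xs @ [d, opposite d] @ drop i xs) else None)"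
| "run_level xs (i, Cap) =
    (if Suc i < length xs \<and> xs ! Suc i = opposite (xs ! i)
     then Some (take i xs @ drop (Suc (Suc i)) xs) else None)"
| "run_level xs (i, Cross c) =
    (if Suc i < length xs
     then Some (take i xs @ [xs ! Suc i, xs ! i] @ drop (Suc (Suc i)) xs) else None)"

fun run :: "direction list \<Rightarrow> level list \<Rightarrow> direction list option" where
  "run xs [] = Some xs"
| "run xs (e # w) = (case run_level xs e of None \<Rightarrow> None | Some ys \<Rightarrow> run ys w)"

lemma split_pair:
  assumes "Suc i < length xs"
  shows "take i xs @ [xs ! i, xs ! Suc i] @ drop (Suc (Suc i)) xs = xs"
  using assms by (simp add: Cons_nth_drop_Suc)

lemma slice_iff_run_level: "slice xs e ys \<longleftrightarrow> run_level xs e = Some ys"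
proof
  show "slice xs e ys \<Longrightarrow> run_level xs e = Some ys"
    by (induction rule: slice.induct) (auto simp: nth_append)
next
  assume run: "run_level xs e = Some ys"
  obtain i p where e: "e = (i, p)" by (cases e)
  show "slice xs e ys"
  proof (cases p)
    case (Cup d)
    then have "i \<le> length xs" "ys = take i xs @ [d, opposite d] @ drop i xs"
      using run e by (auto split: if_splits)
    then show ?thesis
      using slice.cup[of "take i xs" "drop i xs" d] e Cup by simp
  next
    case Cap
    then have "Suc i < length xs" "xs ! Suc i = opposite (xs ! i)"
      "ys = take i xs @ drop (Suc (Suc i)) xs"
      using run e by (auto split: if_splits)
    then show ?thesis
      using slice.cap[of "take i xs" "xs ! i" "drop (Suc (Suc i)) xs"] split_pair[of i xs] e Cap
      by simp
  next
    case (Cross c)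
    then have "Suc i < length xs"
      "ys = take i xs @ [xs ! Suc i, xs ! i] @ drop (Suc (Suc i)) xs"
      using run e by (auto split: if_splits)
    then show ?thesis
      using slice.cross[of "take i xs" "xs ! i" "xs ! Suc i" "drop (Suc (Suc i)) xs" c]
        split_pair[of i xs] e Cross
      by simp
  qed
qed

lemma tangle_iff_run: "tangle xs w ys \<longleftrightarrow> run xs w = Some ys"
proof
  show "tangle xs w ys \<Longrightarrow> run xs w = Some ys"
    by (induction rule: tangle.induct) (auto simp: slice_iff_run_level)
next
  show "run xs w = Some ys \<Longrightarrow> tangle xs w ys"
    by (induction w arbitrary: xs)
      (auto simp: slice_iff_run_level intro!: tangle.intros split: option.splits)
qed

lemma run_append: "run xs (u @ w) = Option.bind (run xs u) (\<lambda>ys. run ys w)"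
  by (induction u arbitrary: xs) (auto split: option.split)

lemma diagram_iff_run: "virtual_link_diagram D \<longleftrightarrow> run [] D = Some []"
  by (simp add: virtual_link_diagram_def tangle_iff_run)

definition shift :: "nat \<Rightarrow> level list \<Rightarrow> level list" where
  "shift k = map (\<lambda>(i, p). (k + i, p))"

lemma shift_simps [simp]:
  "shift k [] = []" "shift k ((i, p) # w) = (k + i, p) # shift k w"
  "shift k (u @ w) = shift k u @ shift k w"
  by (simp_all add: shift_def)

lemma shift_shift [simp]: "shift k (shift m w) = shift (k + m) w"
  by (induction w) (auto simp: shift_def)

lemma slice_shift:
  "slice xs (i, p) ys \<Longrightarrow> slice (ls @ xs @ rs) (length ls + i, p) (ls @ ys @ rs)"
proof (induction xs "(i, p)" ys rule: slice.induct)
  case (cup xs ys d)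
  then show ?case using slice.cup[of "ls @ xs" "ys @ rs" d] by simp
next
  case (cap xs d ys)
  then show ?case using slice.cap[of "ls @ xs" d "ys @ rs"] by simp
next
  case (cross xs d e ys c)
  then show ?case using slice.cross[of "ls @ xs" d e "ys @ rs" c] by simp
qed

lemma run_shift:
  assumes "run xs w = Some ys"
  shows "run (ls @ xs @ rs) (shift (length ls) w) = Some (ls @ ys @ rs)"
proof -
  have "tangle xs w ys \<Longrightarrow> tangle (ls @ xs @ rs) (shift (length ls) w) (ls @ ys @ rs)"
    by (induction rule: tangle.induct)
      (auto intro!: tangle.intros dest: slice_shift)
  with assms show ?thesis by (simp add: tangle_iff_run)
qed


section \<open>Transformations inside a disk\<close>

text \<open>
  Here the word \<open>w\<close> lies in a disk whose lower boundary is crossed by strands with the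
  directions \<open>ds\<close>, while \<open>ls\<close> and \<open>rs\<close> are the strands passing to its left and right. Demanding
  the same strands above \<open>w\<close> and \<open>w'\<close> makes the relation symmetric whenever \<open>R\<close> is, and lets it
  be used inside longer words without checking again that these are diagrams.
\<close>

definition locally ::
  "(diagram \<Rightarrow> diagram \<Rightarrow> bool) \<Rightarrow> direction list \<Rightarrow> level list \<Rightarrow> level list \<Rightarrow> bool" where
  "locally R ds w w' \<longleftrightarrow> (\<forall>ls rs.
     run (ls @ ds @ rs) (shift (length ls) w) = run (ls @ ds @ rs) (shift (length ls) w') \<and>
     (\<forall>u v. run [] u = Some (ls @ ds @ rs) \<longrightarrow>
        virtual_link_diagram (u @ shift (length ls) w @ v) \<longrightarrow>
        R (u @ shift (length ls) w @ v) (u @ shift (length ls) w' @ v)))"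

lemma locally_mono: "locally R ds w w' \<Longrightarrow> R \<le> S \<Longrightarrow> locally S ds w w'"
  unfolding locally_def by blast

lemma diagram_cong:
  assumes "run [] u = Some xs" "run xs w = run xs w'"
  shows "virtual_link_diagram (u @ w @ v) \<longleftrightarrow> virtual_link_diagram (u @ w' @ v)"
  using assms by (simp add: diagram_iff_run run_append)

lemma locally_trans:
  assumes "locally R ds w w'" "locally R ds w' w''" "transp R"
  shows "locally R ds w w''"
  unfolding locally_def
proof (intro allI conjI impI)
  fix ls rs :: "direction list" and u v :: diagram
  let ?s = "shift (length ls)"
  show "run (ls @ ds @ rs) (?s w) = run (ls @ ds @ rs) (?s w'')"
    using assms(1,2) unfolding locally_def by metis
  assume u: "run [] u = Some (ls @ ds @ rs)" and D: "virtual_link_diagram (u @ ?s w @ v)"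
  have "virtual_link_diagram (u @ ?s w' @ v)"
    using D diagram_cong[OF u] assms(1) unfolding locally_def by metis
  then show "R (u @ ?s w @ v) (u @ ?s w'' @ v)"
    using assms u D unfolding locally_def by (meson transpE)
qed

lemma locally_sym:
  assumes "locally R ds w w'" "symp R"
  shows "locally R ds w' w"
  unfolding locally_def
proof (intro allI conjI impI)
  fix ls rs :: "direction list" and u v :: diagram
  let ?s = "shift (length ls)"
  show "run (ls @ ds @ rs) (?s w') = run (ls @ ds @ rs) (?s w)"
    using assms(1) unfolding locally_def by metis
  assume u: "run [] u = Some (ls @ ds @ rs)" and D: "virtual_link_diagram (u @ ?s w' @ v)"
  have "virtual_link_diagram (u @ ?s w @ v)"
    using D diagram_cong[OF u] assms(1) unfolding locally_def by metis
  then show "R (u @ ?s w' @ v) (u @ ?s w @ v)"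
    using assms u unfolding locally_def by (meson sympD)
qed

lemma locally_embed:
  assumes "locally R ds w w'"
  shows "locally R (ls @ ds @ rs) (shift (length ls) w) (shift (length ls) w')"
  unfolding locally_def
proof (intro allI conjI impI)
  fix ls' rs' :: "direction list" and u v :: diagram
  have *: "ls' @ (ls @ ds @ rs) @ rs' = (ls' @ ls) @ ds @ (rs @ rs')"
    and **: "shift (length ls') (shift (length ls) x) = shift (length (ls' @ ls)) x" for x
    by simp_all
  show "run (ls' @ (ls @ ds @ rs) @ rs') (shift (length ls') (shift (length ls) w)) =
        run (ls' @ (ls @ ds @ rs) @ rs') (shift (length ls') (shift (length ls) w'))"
    using assms unfolding locally_def * ** by blast
  show "run [] u = Some (ls' @ (ls @ ds @ rs) @ rs') \<Longrightarrow>
    virtual_link_diagram (u @ shift (length ls') (shift (length ls) w) @ v) \<Longrightarrow>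
    R (u @ shift (length ls') (shift (length ls) w) @ v)
      (u @ shift (length ls') (shift (length ls) w') @ v)"
    using assms unfolding locally_def * ** by blast
qed

lemma locally_context:
  assumes w: "locally R es w w'" and p: "run ds p = Some es"
  shows "locally R ds (p @ w @ q) (p @ w' @ q)"
  unfolding locally_def
proof (intro allI conjI impI)
  fix ls rs :: "direction list" and u v :: diagram
  let ?s = "shift (length ls)"
  have p': "run (ls @ ds @ rs) (?s p) = Some (ls @ es @ rs)"
    by (rule run_shift[OF p])
  show "run (ls @ ds @ rs) (?s (p @ w @ q)) = run (ls @ ds @ rs) (?s (p @ w' @ q))"
    using w by (simp add: run_append p' locally_def)
  assume u: "run [] u = Some (ls @ ds @ rs)"
    and D: "virtual_link_diagram (u @ ?s (p @ w @ q) @ v)"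
  have "run [] (u @ ?s p) = Some (ls @ es @ rs)"
    by (simp add: run_append u p')
  moreover have "virtual_link_diagram ((u @ ?s p) @ ?s w @ (?s q @ v))"
    using D by simp
  ultimately have "R ((u @ ?s p) @ ?s w @ (?s q @ v)) ((u @ ?s p) @ ?s w' @ (?s q @ v))"
    using w unfolding locally_def by blast
  then show "R (u @ ?s (p @ w @ q) @ v) (u @ ?s (p @ w' @ q) @ v)"
    by simp
qed

text \<open>
  One step of a calculation with explicit words: the subword \<open>l\<close> after the first \<open>k\<close> levels is
  replaced. On explicit words the simplifier proves the last three premises by evaluation.
\<close>

lemma rewrite:
  assumes "locally R (the (run ds (take k w))) l r"
    and "run ds (take k w) \<noteq> None"
    and "w = take k w @ l @ drop (k + length l) w"
    and "w' = take k w @ r @ drop (k + length l) w"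
  shows "locally R ds w w'"
proof -
  have "run ds (take k w) = Some (the (run ds (take k w)))"
    using assms(2) by simp
  from locally_context[OF assms(1) this, of "drop (k + length l) w"] show ?thesis
    unfolding assms(3)[symmetric] assms(4)[symmetric] .
qed

lemma locally_at_2:
  assumes "\<And>a b. locally R [a, b] w w'" and i: "Suc i < length xs"
  shows "locally R xs (shift i w) (shift i w')"
proof -
  have "length (take i xs) = i"
    using i by simp
  with locally_embed[OF assms(1), of "take i xs" "xs ! i" "xs ! Suc i" "drop (Suc (Suc i)) xs"]
  show ?thesis
    unfolding split_pair[OF i] by simp
qed

lemma split_triple:
  assumes "Suc (Suc i) < length xs"
  obtains ls a b c rs where "xs = ls @ [a, b, c] @ rs" "length ls = i"
proof
  show "xs = take i xs @ [xs ! i, xs ! Suc i, xs ! Suc (Suc i)] @ drop (Suc (Suc (Suc i))) xs"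
    "length (take i xs) = i"
    using assms by (simp_all add: Cons_nth_drop_Suc)
qed

lemma locally_at_3:
  assumes "\<And>a b c. locally R [a, b, c] w w'" and i: "Suc (Suc i) < length xs"
  shows "locally R xs (shift i w) (shift i w')"
proof -
  obtain ls a b c rs where "xs = ls @ [a, b, c] @ rs" "length ls = i"
    using split_triple[OF i] .
  then show ?thesis
    using locally_embed[OF assms(1), of ls a b c rs] by simp
qed

lemma local_moveI: "replacement R D D' \<Longrightarrow> local_move R D D'"
  unfolding local_move_def planar_isotopic_def by blast

lemma locally_replacement:
  assumes rule: "R l r" and shifts: "\<And>k l r. R l r \<Longrightarrow> R (shift k l) (shift k r)"
    and l: "run ds l = Some es" and r: "run ds r = Some es"
  shows "locally (replacement R) ds l r"
  unfolding locally_def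
proof (intro allI conjI impI)
  fix ls rs :: "direction list" and u v :: diagram
  let ?s = "shift (length ls)"
  show run: "run (ls @ ds @ rs) (?s l) = run (ls @ ds @ rs) (?s r)"
    by (simp add: run_shift[OF l] run_shift[OF r])
  assume u: "run [] u = Some (ls @ ds @ rs)" and D: "virtual_link_diagram (u @ ?s l @ v)"
  have "virtual_link_diagram (u @ ?s r @ v)"
    using D diagram_cong[OF u run] by simp
  then show "replacement R (u @ ?s l @ v) (u @ ?s r @ v)"
    using D shifts[OF rule] unfolding replacement_def by blast
qed

lemma isotopy_rule_shift: "isotopy_rule l r \<Longrightarrow> isotopy_rule (shift k l) (shift k r)"
proof (induction rule: isotopy_rule.induct)
  case (exchange i p m q)
  then show ?case using isotopy_rule.exchange[of "k + i" p m q] by (simp add: add.assoc)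
qed (auto intro: isotopy_rule.intros)

lemma reidemeister_rule_shift:
  "reidemeister_rule l r \<Longrightarrow> reidemeister_rule (shift k l) (shift k r)"
proof (induction rule: reidemeister_rule.induct)
  case (III a b c i)
  then show ?case using reidemeister_rule.III[of a b c "k + i"] by (simp add: triangle_def)
qed (auto intro: reidemeister_rule.intros)

definition reidemeister_equivalent :: "diagram \<Rightarrow> diagram \<Rightarrow> bool" where
  "reidemeister_equivalent = (sup generalized_reidemeister_move planar_isotopic)\<^sup>*\<^sup>*"

lemma symp_planar_isotopic: "symp planar_isotopic"
  unfolding planar_isotopic_def by (rule symp_rtranclp) (auto simp: symp_def)

lemma symp_reidemeister_equivalent: "symp reidemeister_equivalent"
  unfolding reidemeister_equivalent_def
  using symp_planar_isotopic
  by (intro symp_rtranclp) (auto simp: symp_def generalized_reidemeister_move_def)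

lemma reidemeister_equivalent_realized: "reidemeister_equivalent \<le> realized_by X"
  unfolding reidemeister_equivalent_def realized_by_def by (rule rtranclp_mono) auto

abbreviation equivalent ("_ \<turnstile> _ \<approx> _" [51, 51, 51] 50) where
  "ds \<turnstile> w \<approx> w' \<equiv> locally reidemeister_equivalent ds w w'"

abbreviation leads :: "move_type \<Rightarrow> direction list \<Rightarrow> level list \<Rightarrow> level list \<Rightarrow> bool" where
  "leads X \<equiv> locally (realized_by X)"

lemma eqv_sym: "ds \<turnstile> w \<approx> w' \<Longrightarrow> ds \<turnstile> w' \<approx> w"
  by (rule locally_sym[OF _ symp_reidemeister_equivalent])

lemma eqv_trans [trans]: "ds \<turnstile> w \<approx> w' \<Longrightarrow> ds \<turnstile> w' \<approx> w'' \<Longrightarrow> ds \<turnstile> w \<approx> w''"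
  by (erule (1) locally_trans) (simp add: reidemeister_equivalent_def)

lemma leads_trans [trans]: "leads X ds w w' \<Longrightarrow> leads X ds w' w'' \<Longrightarrow> leads X ds w w''"
  by (erule (1) locally_trans) (simp add: realized_by_def)

lemma leads_if_eqv: "ds \<turnstile> w \<approx> w' \<Longrightarrow> leads X ds w w'"
  by (rule locally_mono[OF _ reidemeister_equivalent_realized])

lemma eqv_leads_trans [trans]: "ds \<turnstile> w \<approx> w' \<Longrightarrow> leads X ds w' w'' \<Longrightarrow> leads X ds w w''"
  by (rule leads_trans[OF leads_if_eqv])

lemma leads_eqv_trans [trans]: "leads X ds w w' \<Longrightarrow> ds \<turnstile> w' \<approx> w'' \<Longrightarrow> leads X ds w w''"
  by (rule leads_trans[OF _ leads_if_eqv])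

lemma isotopy:
  assumes "isotopy_rule l r" "run ds l \<noteq> None" "run ds r = run ds l"
  shows "ds \<turnstile> l \<approx> r"
proof (rule locally_mono)
  show "locally (replacement isotopy_rule) ds l r"
    using assms locally_replacement[of isotopy_rule, OF assms(1) isotopy_rule_shift] by auto
  show "replacement isotopy_rule \<le> reidemeister_equivalent"
    by (auto simp: reidemeister_equivalent_def planar_isotopic_def)
qed

lemma reidemeister:
  assumes "reidemeister_rule l r" "run ds l \<noteq> None" "run ds r = run ds l"
  shows "ds \<turnstile> l \<approx> r"
proof (rule locally_mono)
  show "locally (replacement reidemeister_rule) ds l r"
    using assms locally_replacement[of reidemeister_rule, OF assms(1) reidemeister_rule_shift]
    by auto
  show "replacement reidemeister_rule \<le> reidemeister_equivalent"
    by (auto simp: reidemeister_equivalent_def generalized_reidemeister_move_def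
        dest!: local_moveI)
qed


section \<open>Virtual braids\<close>

lemma other_other [simp]: "other (other s) = s"
  by (cases s) auto

lemma swap_swap [simp]: "swap (swap c) = c"
  by (cases c) auto

lemma opposite_opposite [simp]: "opposite (opposite d) = d"
  by (cases d) auto

abbreviation C :: "crossing \<Rightarrow> nat \<Rightarrow> level" where "C c i \<equiv> (i, Cross c)"
abbreviation V :: "nat \<Rightarrow> level" where "V i \<equiv> (i, Cross Virtual)"

text \<open>
  For words consisting of crossings only, the number of strands decides whether they fit,
  so that calculations with them need neither explicit positions nor directions.
\<close>

definition braid :: "nat \<Rightarrow> level list \<Rightarrow> bool" where
  "braid n w \<longleftrightarrow> (\<forall>(i, p) \<in> set w. Suc i < n \<and> (\<exists>c. p = Cross c))"

lemma braid_simps [simp]: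
  "braid n []" "braid n ((i, Cross c) # w) \<longleftrightarrow> Suc i < n \<and> braid n w"
  by (auto simp: braid_def)

lemma run_braid:
  "braid (length xs) w \<Longrightarrow> \<exists>ys. run xs w = Some ys \<and> length ys = length xs"
proof (induction w arbitrary: xs)
  case (Cons e w)
  then obtain i c where e: "e = (i, Cross c)" "Suc i < length xs" "braid (length xs) w"
    by (auto simp: braid_def)
  let ?ys = "take i xs @ [xs ! Suc i, xs ! i] @ drop (Suc (Suc i)) xs"
  have "length ?ys = length xs"
    using e(2) by simp
  with Cons.IH[of ?ys] e show ?case
    by simp
qed simp

lemma rewrite_braid:
  assumes "\<And>ys. length ys = length xs \<Longrightarrow> locally R ys l r"
    and "braid (length xs) (take k w)"
    and "w = take k w @ l @ drop (k + length l) w"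
    and "w' = take k w @ r @ drop (k + length l) w"
  shows "locally R xs w w'"
proof -
  obtain ys where "run xs (take k w) = Some ys" "length ys = length xs"
    using run_braid[OF assms(2)] by blast
  then show ?thesis
    using assms(1) by (intro rewrite[OF _ _ assms(3,4)]) simp_all
qed

definition adjacent :: "nat \<Rightarrow> nat \<Rightarrow> nat \<Rightarrow> bool" where
  "adjacent n i j \<longleftrightarrow> (j = Suc i \<or> i = Suc j) \<and> Suc i < n \<and> Suc j < n"

lemma adjacentD:
  assumes "adjacent n i j"
  shows "adjacent n j i" "Suc i < n" "Suc j < n"
  using assms by (auto simp: adjacent_def)

lemma cancel: "Suc i < length xs \<Longrightarrow> xs \<turnstile> [C c i, C (swap c) i] \<approx> []"
  using locally_at_2[OF reidemeister[OF II[of 0 c]], of i xs] by simp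

lemma cancel_swap: "Suc i < length xs \<Longrightarrow> xs \<turnstile> [C (swap c) i, C c i] \<approx> []"
  using cancel[of i xs "swap c"] by simp

lemma cancel_virtual: "Suc i < length xs \<Longrightarrow> xs \<turnstile> [V i, V i] \<approx> []"
  using cancel[of i xs Virtual] by simp

lemma third_move_crossings_detour:
  "third_move_crossings Virtual Virtual c" "third_move_crossings c Virtual Virtual"
  by (cases c; auto intro: third_move_crossings.intros)+

text \<open>
  A strand with two virtual crossings passes any crossing. With \<open>c\<close> virtual this is
  the purely virtual third move.
\<close>

lemma detour:
  assumes "adjacent (length xs) i j"
  shows "xs \<turnstile> [V i, V j, C c i] \<approx> [C c j, V i, V j]"
proof (cases "j = Suc i")
  case True
  show ?thesis
    using locally_at_3[OF reidemeister[OF III[OF third_move_crossings_detour(1)[of c], of 0]],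
        of i xs] assms True
    by (simp add: triangle_def adjacent_def)
next
  case False
  then show ?thesis
    using locally_at_3[OF eqv_sym[OF
          reidemeister[OF III[OF third_move_crossings_detour(2)[of c], of 0]]], of j xs] assms
    by (simp add: triangle_def adjacent_def)
qed

lemmas virtual_triangle = detour[where c = Virtual]

lemma virtual_triangle_twice:
  assumes "adjacent (length xs) i j"
  shows "xs \<turnstile> [] \<approx> [V i, V j, V i, V i, V j, V i]"
proof -
  note [simp] = adjacentD[OF assms]
  have "xs \<turnstile> [V i, V j, V i, V i, V j, V i] \<approx> [V i, V j, V j, V i]"
    by (rule rewrite_braid[where k = 2, OF cancel_virtual]) simp_all
  also have "xs \<turnstile> \<dots> \<approx> [V i, V i]"
    by (rule rewrite_braid[where k = 1, OF cancel_virtual]) simp_all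
  also have "xs \<turnstile> \<dots> \<approx> []"
    by (rule cancel_virtual) simp
  finally show ?thesis by (rule eqv_sym)
qed


section \<open>Kinks\<close>

text \<open>
  A virtual crossing on top of a minimum exchanges its two legs, and so reverses its direction.
  The rules of the first move only remove kinks from a strand that continues both upwards and
  downwards. Therefore a kink is created on the left leg of the minimum; the minimum of the kink
  is lowered below the original one and takes its place, and the original one is straightened
  away. The same is done with a maximum in lemma \<open>virtual_cap\<close>.
\<close>

lemma virtual_cup:
  assumes "i \<le> length xs"
  shows "xs \<turnstile> [(i, Cup d)] \<approx> [(i, Cup (opposite d)), V i]"
proof -
  let ?e = "opposite d"
  have kink: "[d, ?e] \<turnstile> [] \<approx> [(0, Cup ?e), V 0, (1, Cap)]"
  proof -
    have "[d, ?e] \<turnstile> [(0, Cup ?e), V 0, (1, Cap)] \<approx> [(0, Cup ?e), V 1, (0, Cap)]"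
      by (rule rewrite[where k = 1, OF eqv_sym[OF isotopy[OF cap_crossing[of 0 Virtual]]]]) simp_all
    also have "[d, ?e] \<turnstile> \<dots> \<approx> []"
      using reidemeister[OF I_left[of 0 ?e Virtual], of "[d, ?e]"] by simp
    finally show ?thesis by (rule eqv_sym)
  qed
  have "[] \<turnstile> [(0, Cup d)] \<approx> [(0, Cup d), (0, Cup ?e), V 0, (1, Cap)]"
    by (rule rewrite[where k = 1 and l = "[]" and r = "[(0, Cup ?e), V 0, (1, Cap)]"])
      (use kink in simp_all)
  also have "[] \<turnstile> \<dots> \<approx> [(0, Cup ?e), (2, Cup d), V 0, (1, Cap)]"
    by (rule rewrite[where k = 0,
          OF eqv_sym[OF isotopy[OF exchange[of 0 "Cup ?e" 0 "Cup d"]]]]) simp_all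
  also have "[] \<turnstile> \<dots> \<approx> [(0, Cup ?e), V 0, (2, Cup d), (1, Cap)]"
    by (rule rewrite[where k = 1,
          OF eqv_sym[OF isotopy[OF exchange[of 0 "Cross Virtual" 0 "Cup d"]]]]) simp_all
  also have "[] \<turnstile> \<dots> \<approx> [(0, Cup ?e), V 0]"
    by (rule rewrite[where k = 2, OF isotopy[OF straighten_S[of 1 d]]]) simp_all
  finally show ?thesis
    using locally_embed[of _ "[]" "[(0, Cup d)]" "[(0, Cup ?e), V 0]" "take i xs" "drop i xs"] assms
    by simp
qed

lemma virtual_cap:
  assumes "Suc i < length xs" "xs ! Suc i = opposite (xs ! i)"
  shows "xs \<turnstile> [V i, (i, Cap)] \<approx> [(i, Cap)]"
proof -
  let ?a = "xs ! i"
  let ?e = "opposite ?a"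
  have kink: "[?a, ?e] \<turnstile> [(1, Cup ?e), V 0, (0, Cap)] \<approx> []"
  proof -
    have "[?a, ?e] \<turnstile> [(1, Cup ?e), V 0, (0, Cap)] \<approx> [(0, Cup ?e), V 1, (0, Cap)]"
      by (rule rewrite[where k = 0, OF eqv_sym[OF isotopy[OF cup_crossing[of 0 ?e Virtual]]]])
        simp_all
    also have "[?a, ?e] \<turnstile> \<dots> \<approx> []"
      using reidemeister[OF I_left[of 0 ?e Virtual], of "[?a, ?e]"] by simp
    finally show ?thesis .
  qed
  have "[?a, ?e] \<turnstile> [V 0, (0, Cap)] \<approx> [(1, Cup ?e), (2, Cap), V 0, (0, Cap)]"
    by (rule rewrite[where k = 0, OF eqv_sym[OF isotopy[OF straighten_Z[of 1 ?e]]]]) simp_all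
  also have "[?a, ?e] \<turnstile> \<dots> \<approx> [(1, Cup ?e), V 0, (2, Cap), (0, Cap)]"
    by (rule rewrite[where k = 1,
          OF eqv_sym[OF isotopy[OF exchange[of 0 "Cross Virtual" 0 Cap]]]]) simp_all
  also have "[?a, ?e] \<turnstile> \<dots> \<approx> [(1, Cup ?e), V 0, (0, Cap), (0, Cap)]"
    by (rule rewrite[where k = 2, OF eqv_sym[OF isotopy[OF exchange[of 0 Cap 0 Cap]]]]) simp_all
  also have "[?a, ?e] \<turnstile> \<dots> \<approx> [(0, Cap)]"
    by (rule rewrite[where k = 0 and l = "[(1, Cup ?e), V 0, (0, Cap)]" and r = "[]"])
      (use kink in simp_all)
  finally show ?thesis
    using locally_embed[of _ "[?a, ?e]" "[V 0, (0, Cap)]" "[(0, Cap)]" "take i xs"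
        "drop (Suc (Suc i)) xs"] split_pair[OF assms(1)] assms
    by simp
qed


section \<open>Turning a crossing\<close>

text \<open>
  The strand from bottom left to top right is bent so that it passes through the crossing
  downwards. In the middle level the crossing is thus seen turned by a quarter of a full turn: the
  strand that was its \<open>Backslash\<close> branch is now its \<open>Slash\<close> branch, hence the swap. Bending the
  other strand to the other side gives lemma \<open>crossing_turned_left\<close>.
\<close>

lemma crossing_turned_right:
  "[a, b] \<turnstile> [C c 0] \<approx> [(2, Cup (opposite a)), C (swap c) 1, (0, Cap)]"
proof -
  have "[a, b] \<turnstile> [C c 0] \<approx> [C c 0, (2, Cup (opposite a)), (1, Cap)]"
    by (rule rewrite[where k = 1, OF eqv_sym[OF isotopy[OF straighten_S[of 1 "opposite a"]]]])
      simp_all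
  also have "[a, b] \<turnstile> \<dots> \<approx> [(2, Cup (opposite a)), C c 0, (1, Cap)]"
    by (rule rewrite[where k = 0,
          OF isotopy[OF exchange[of 0 "Cross c" 0 "Cup (opposite a)"]]]) simp_all
  also have "[a, b] \<turnstile> \<dots> \<approx> [(2, Cup (opposite a)), C (swap c) 1, (0, Cap)]"
    by (rule rewrite[where k = 1, OF eqv_sym[OF isotopy[OF cap_crossing[of 0 "swap c"]]]]) simp_all
  finally show ?thesis .
qed

lemma crossing_turned_left:
  "[a, b] \<turnstile> [C c 0] \<approx> [(0, Cup b), C (swap c) 1, (2, Cap)]"
proof -
  have "[a, b] \<turnstile> [C c 0] \<approx> [C c 0, (0, Cup b), (1, Cap)]"
    by (rule rewrite[where k = 1, OF eqv_sym[OF isotopy[OF straighten_Z[of 0 b]]]]) simp_all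
  also have "[a, b] \<turnstile> \<dots> \<approx> [(0, Cup b), C c 2, (1, Cap)]"
    by (rule rewrite[where k = 0,
          OF eqv_sym[OF isotopy[OF exchange[of 0 "Cup b" 0 "Cross c"]]]]) simp_all
  also have "[a, b] \<turnstile> \<dots> \<approx> [(0, Cup b), C (swap c) 1, (2, Cap)]"
    by (rule rewrite[where k = 1, OF isotopy[OF cap_crossing[of 1 c]]]) simp_all
  finally show ?thesis .
qed

text \<open>
  By the next two lemmas, flanking a crossing by virtual crossings on its left and right and
  flanking it by virtual crossings below and above amount to the same: turned to one side and to
  the other side, respectively, both take the common form on the right-hand sides. It is in this
  comparison that the virtual first move enters, in the form of lemmas \<open>virtual_cup\<close> and
  \<open>virtual_cap\<close>.
\<close>

lemma flanked_turned_right: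
  "[a, b] \<turnstile> [(2, Cup (opposite a)), V 1, C c 1, V 1, (0, Cap)] \<approx>
    [(1, Cup a), C c 2, V 1, V 0, V 2, (1, Cap)]"
proof -
  let ?d = "opposite a"
  have "[a, b] \<turnstile> [(2, Cup ?d), V 1, C c 1, V 1, (0, Cap)] \<approx>
      [(2, Cup ?d), V 1, C c 1, V 0, (1, Cap)]"
    by (rule rewrite[where k = 3, OF isotopy[OF cap_crossing[of 0 Virtual]]]) simp_all
  also have "[a, b] \<turnstile> \<dots> \<approx> [(1, Cup ?d), V 2, C c 1, V 0, (1, Cap)]"
    by (rule rewrite[where k = 0, OF eqv_sym[OF isotopy[OF cup_crossing[of 1 ?d Virtual]]]])
      simp_all
  also have "[a, b] \<turnstile> \<dots> \<approx> [(1, Cup a), V 1, V 2, C c 1, V 0, (1, Cap)]"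
    by (rule rewrite[where k = 0, OF virtual_cup[of 1 _ ?d]]) simp_all
  also have "[a, b] \<turnstile> \<dots> \<approx> [(1, Cup a), C c 2, V 1, V 2, V 0, (1, Cap)]"
    by (rule rewrite[where k = 1, OF detour[of _ 1 2 c]]) (simp_all add: adjacent_def)
  also have "[a, b] \<turnstile> \<dots> \<approx> [(1, Cup a), C c 2, V 1, V 0, V 2, (1, Cap)]"
    by (rule rewrite[where k = 3,
          OF eqv_sym[OF isotopy[OF exchange[of 0 "Cross Virtual" 0 "Cross Virtual"]]]]) simp_all
  finally show ?thesis .
qed

lemma flanked_turned_left:
  "[a, b] \<turnstile> [V 0, C (swap c) 0, V 0] \<approx> [(1, Cup a), C c 2, V 1, V 0, V 2, (1, Cap)]"
proof -
  have "[a, b] \<turnstile> [V 0, C (swap c) 0, V 0] \<approx> [V 0, (0, Cup a), C c 1, (2, Cap), V 0]"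
    by (rule rewrite[where k = 1 and l = "[C (swap c) 0]"])
      (use crossing_turned_left[of b a "swap c"] in simp_all)
  also have "[a, b] \<turnstile> \<dots> \<approx> [(0, Cup a), V 2, C c 1, (2, Cap), V 0]"
    by (rule rewrite[where k = 0,
          OF eqv_sym[OF isotopy[OF exchange[of 0 "Cup a" 0 "Cross Virtual"]]]]) simp_all
  also have "[a, b] \<turnstile> \<dots> \<approx> [(0, Cup a), V 2, C c 1, V 0, (2, Cap)]"
    by (rule rewrite[where k = 3,
          OF eqv_sym[OF isotopy[OF exchange[of 0 "Cross Virtual" 0 Cap]]]]) simp_all
  also have "[a, b] \<turnstile> \<dots> \<approx> [(0, Cup a), V 1, V 1, V 2, C c 1, V 0, (2, Cap)]"
    by (rule rewrite[where k = 1, OF eqv_sym[OF cancel_virtual[of 1]]]) simp_all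
  also have "[a, b] \<turnstile> \<dots> \<approx> [(1, Cup a), V 0, V 1, V 2, C c 1, V 0, (2, Cap)]"
    by (rule rewrite[where k = 0, OF isotopy[OF cup_crossing[of 0 a Virtual]]]) simp_all
  also have "[a, b] \<turnstile> \<dots> \<approx> [(1, Cup a), V 0, C c 2, V 1, V 2, V 0, (2, Cap)]"
    by (rule rewrite[where k = 2, OF detour[of _ 1 2 c]]) (simp_all add: adjacent_def)
  also have "[a, b] \<turnstile> \<dots> \<approx> [(1, Cup a), C c 2, V 0, V 1, V 2, V 0, (2, Cap)]"
    by (rule rewrite[where k = 1,
          OF isotopy[OF exchange[of 0 "Cross Virtual" 0 "Cross c"]]]) simp_all
  also have "[a, b] \<turnstile> \<dots> \<approx> [(1, Cup a), C c 2, V 0, V 1, V 2, V 0, V 1, V 1, (2, Cap)]"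
    by (rule rewrite[where k = 6, OF eqv_sym[OF cancel_virtual[of 1]]]) simp_all
  also have "[a, b] \<turnstile> \<dots> \<approx> [(1, Cup a), C c 2, V 0, V 1, V 2, V 0, V 1, V 2, (1, Cap)]"
    by (rule rewrite[where k = 7, OF eqv_sym[OF isotopy[OF cap_crossing[of 1 Virtual]]]]) simp_all
  also have "[a, b] \<turnstile> \<dots> \<approx> [(1, Cup a), C c 2, V 0, V 1, V 0, V 2, V 1, V 2, (1, Cap)]"
    by (rule rewrite[where k = 4,
          OF eqv_sym[OF isotopy[OF exchange[of 0 "Cross Virtual" 0 "Cross Virtual"]]]]) simp_all
  also have "[a, b] \<turnstile> \<dots> \<approx> [(1, Cup a), C c 2, V 1, V 0, V 1, V 2, V 1, V 2, (1, Cap)]"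
    by (rule rewrite[where k = 2, OF virtual_triangle[of _ 0 1]]) (simp_all add: adjacent_def)
  also have "[a, b] \<turnstile> \<dots> \<approx> [(1, Cup a), C c 2, V 1, V 0, V 1, V 1, V 2, V 1, (1, Cap)]"
    by (rule rewrite[where k = 5, OF virtual_triangle[of _ 2 1]]) (simp_all add: adjacent_def)
  also have "[a, b] \<turnstile> \<dots> \<approx> [(1, Cup a), C c 2, V 1, V 0, V 2, V 1, (1, Cap)]"
    by (rule rewrite[where k = 4, OF cancel_virtual[of 1]]) simp_all
  also have "[a, b] \<turnstile> \<dots> \<approx> [(1, Cup a), C c 2, V 1, V 0, V 2, (1, Cap)]"
    by (rule rewrite[where k = 5, OF virtual_cap[of 1]]) simp_all
  finally show ?thesis .
qed


section \<open>From one alternating pattern to the other\<close>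

definition adds :: "move_type \<Rightarrow> crossing \<Rightarrow> bool" where
  "adds X c \<longleftrightarrow> (\<forall>xs i j. adjacent (length xs) i j \<longrightarrow>
     leads X xs [V i, V j, V i] [C c i, C (swap c) j, C c i])"

definition removes :: "move_type \<Rightarrow> crossing \<Rightarrow> bool" where
  "removes X c \<longleftrightarrow> (\<forall>xs i j. adjacent (length xs) i j \<longrightarrow>
     leads X xs [C c i, C (swap c) j, C c i] [V i, V j, V i])"

lemma cancel_alternating:
  assumes "adjacent (length xs) i j"
  shows "xs \<turnstile> [C (swap c) i, C c j, C (swap c) i, C c i, C (swap c) j, C c i] \<approx> []"
proof -
  note [simp] = adjacentD[OF assms]
  have "xs \<turnstile> [C (swap c) i, C c j, C (swap c) i, C c i, C (swap c) j, C c i] \<approx>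
      [C (swap c) i, C c j, C (swap c) j, C c i]"
    by (rule rewrite_braid[where k = 2, OF cancel_swap]) simp_all
  also have "xs \<turnstile> \<dots> \<approx> [C (swap c) i, C c i]"
    by (rule rewrite_braid[where k = 1, OF cancel]) simp_all
  also have "xs \<turnstile> \<dots> \<approx> []"
    by (rule cancel_swap) simp
  finally show ?thesis .
qed

text \<open>
  The two alternating patterns are inverse words. In front of the virtual triangle a pattern and its
  inverse are created; removing the latter leaves two virtual triangles, which cancel.
\<close>

lemma adds_swap_if_removes:
  assumes "removes X c"
  shows "adds X (swap c)"
  unfolding adds_def swap_swap
proof (intro allI impI)
  fix xs :: "direction list" and i j
  assume ij: "adjacent (length xs) i j"
  note [simp] = adjacentD[OF ij] ij
  have "xs \<turnstile> [V i, V j, V i] \<approx>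
      [C (swap c) i, C c j, C (swap c) i, C c i, C (swap c) j, C c i, V i, V j, V i]"
    by (rule rewrite_braid[where k = 0, OF eqv_sym[OF cancel_alternating]]) simp_all
  also have "leads X xs \<dots> [C (swap c) i, C c j, C (swap c) i, V i, V j, V i, V i, V j, V i]"
    by (rule rewrite_braid[where k = 3, OF assms[unfolded removes_def, rule_format]]) simp_all
  also have "xs \<turnstile> \<dots> \<approx> [C (swap c) i, C c j, C (swap c) i]"
    by (rule rewrite_braid[where k = 3, OF eqv_sym[OF virtual_triangle_twice]]) simp_all
  finally show "leads X xs [V i, V j, V i] [C (swap c) i, C c j, C (swap c) i]" .
qed

lemma removes_swap_if_adds:
  assumes "adds X c"
  shows "removes X (swap c)"
  unfolding removes_def swap_swap
proof (intro allI impI)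
  fix xs :: "direction list" and i j
  assume ij: "adjacent (length xs) i j"
  note [simp] = adjacentD[OF ij] ij
  have "xs \<turnstile> [C (swap c) i, C c j, C (swap c) i] \<approx>
      [C (swap c) i, C c j, C (swap c) i, V i, V j, V i, V i, V j, V i]"
    by (rule rewrite_braid[where k = 3, OF virtual_triangle_twice]) simp_all
  also have "leads X xs \<dots>
      [C (swap c) i, C c j, C (swap c) i, C c i, C (swap c) j, C c i, V i, V j, V i]"
    by (rule rewrite_braid[where k = 3, OF assms[unfolded adds_def, rule_format]]) simp_all
  also have "xs \<turnstile> \<dots> \<approx> [V i, V j, V i]"
    by (rule rewrite_braid[where k = 0, OF cancel_alternating]) simp_all
  finally show "leads X xs [C (swap c) i, C c j, C (swap c) i] [V i, V j, V i]" .
qed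

text \<open>
  Two virtual triangles are created and the first one becomes \<open>c\<^sub>i c'\<^sub>j c\<^sub>i\<close>. Between \<open>c'\<^sub>j\<close> and
  the last \<open>c\<^sub>i\<close> a second pattern \<open>c\<^sub>j c'\<^sub>i c\<^sub>j\<close> is made, with the positions interchanged, since
  it begins with the inverse of \<open>c\<^sub>i c'\<^sub>j\<close>. Of six real crossings only two survive, and they
  involve the same two strands with the same one on top.
\<close>

lemma crossing_square_inserted:
  assumes "adds X c" and ij: "adjacent (length xs) i j"
  shows "leads X xs [] [C c j, V j, C c j, V j]"
proof -
  let ?c = "swap c"
  note [simp] = adjacentD[OF ij] ij
  note adds = assms(1)[unfolded adds_def, rule_format]
  have "xs \<turnstile> [] \<approx> [V i, V j, V i, V i, V j, V i]"
    by (rule virtual_triangle_twice) simp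
  also have "leads X xs \<dots> [C c i, C ?c j, C c i, V i, V j, V i]"
    by (rule rewrite_braid[where k = 0, OF adds]) simp_all
  also have "xs \<turnstile> \<dots> \<approx>
      [C c i, C ?c j, V j, V i, V j, V j, V i, V j, C c i, V i, V j, V i]"
    by (rule rewrite_braid[where k = 2, OF virtual_triangle_twice[of _ j i]]) simp_all
  also have "leads X xs \<dots>
      [C c i, C ?c j, C c j, C ?c i, C c j, V j, V i, V j, C c i, V i, V j, V i]"
    by (rule rewrite_braid[where k = 2, OF adds[of _ j i]]) simp_all
  also have "xs \<turnstile> \<dots> \<approx> [C c i, C ?c i, C c j, V j, V i, V j, C c i, V i, V j, V i]"
    by (rule rewrite_braid[where k = 1, OF cancel_swap]) simp_all
  also have "xs \<turnstile> \<dots> \<approx> [C c j, V j, V i, V j, C c i, V i, V j, V i]"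
    by (rule rewrite_braid[where k = 0, OF cancel]) simp_all
  also have "xs \<turnstile> \<dots> \<approx> [C c j, V j, C c j, V i, V j, V i, V j, V i]"
    by (rule rewrite_braid[where k = 2, OF detour]) simp_all
  also have "xs \<turnstile> \<dots> \<approx> [C c j, V j, C c j, V j, V i, V j, V j, V i]"
    by (rule rewrite_braid[where k = 3, OF virtual_triangle]) simp_all
  also have "xs \<turnstile> \<dots> \<approx> [C c j, V j, C c j, V j, V i, V i]"
    by (rule rewrite_braid[where k = 5, OF cancel_virtual]) simp_all
  also have "xs \<turnstile> \<dots> \<approx> [C c j, V j, C c j, V j]"
    by (rule rewrite_braid[where k = 4, OF cancel_virtual]) simp_all
  finally show ?thesis .
qed

text \<open>
  Turning makes \<open>c\<close> into \<open>c'\<close>, so the inserted square can cancel it although it contains only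
  crossings of the kind \<open>c\<close>. The square needs a third strand beside it; the right leg of
  the minimum that turns the crossing serves as one, so that no further strand has to be present.
\<close>

lemma crossing_to_flanked:
  assumes "adds X c" "Suc i < length xs"
  shows "leads X xs [C c i] [V i, C (swap c) i, V i]"
proof -
  have "leads X [a, b] [C c 0] [V 0, C (swap c) 0, V 0]" for a b
  proof -
    let ?d = "opposite a"
    have "[a, b] \<turnstile> [C c 0] \<approx> [(2, Cup ?d), C (swap c) 1, (0, Cap)]"
      by (rule crossing_turned_right)
    also have "[a, b] \<turnstile> \<dots> \<approx> [(2, Cup ?d), V 1, V 1, C (swap c) 1, (0, Cap)]"
      by (rule rewrite[where k = 1, OF eqv_sym[OF cancel_virtual[of 1]]]) simp_all
    also have "leads X [a, b] \<dots>
        [(2, Cup ?d), V 1, C c 1, V 1, C c 1, V 1, V 1, C (swap c) 1, (0, Cap)]"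
      by (rule rewrite[where k = 2, OF crossing_square_inserted[OF assms(1), of _ 2 1]])
        (simp_all add: adjacent_def)
    also have "[a, b] \<turnstile> \<dots> \<approx> [(2, Cup ?d), V 1, C c 1, V 1, C c 1, C (swap c) 1, (0, Cap)]"
      by (rule rewrite[where k = 5, OF cancel_virtual[of 1]]) simp_all
    also have "[a, b] \<turnstile> \<dots> \<approx> [(2, Cup ?d), V 1, C c 1, V 1, (0, Cap)]"
      by (rule rewrite[where k = 4, OF cancel[of 1]]) simp_all
    also have "[a, b] \<turnstile> \<dots> \<approx> [(1, Cup a), C c 2, V 1, V 0, V 2, (1, Cap)]"
      by (rule flanked_turned_right)
    also have "[a, b] \<turnstile> \<dots> \<approx> [V 0, C (swap c) 0, V 0]"
      by (rule eqv_sym[OF flanked_turned_left])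
    finally show ?thesis .
  qed
  from locally_at_2[OF this assms(2)] show ?thesis by simp
qed

text \<open>
  In this direction no turning is needed, since \<open>c'\<close> is already present to cancel
  the second crossing of the square.
\<close>

lemma flanked_to_crossing:
  assumes "adds X c" and ij: "adjacent (length xs) i j"
  shows "leads X xs [V j, C (swap c) j, V j] [C c j]"
proof -
  note [simp] = adjacentD[OF ij] ij
  have "leads X xs [V j, C (swap c) j, V j] [C c j, V j, C c j, V j, V j, C (swap c) j, V j]"
    by (rule rewrite_braid[where k = 0, OF crossing_square_inserted[OF assms(1), of _ i j]]) simp_all
  also have "xs \<turnstile> \<dots> \<approx> [C c j, V j, C c j, C (swap c) j, V j]"
    by (rule rewrite_braid[where k = 3, OF cancel_virtual]) simp_all
  also have "xs \<turnstile> \<dots> \<approx> [C c j, V j, V j]"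
    by (rule rewrite_braid[where k = 2, OF cancel]) simp_all
  also have "xs \<turnstile> \<dots> \<approx> [C c j]"
    by (rule rewrite_braid[where k = 1, OF cancel_virtual]) simp_all
  finally show ?thesis .
qed

lemma flanked_to_crossing_swap:
  assumes "adds X c" and i: "Suc i < length xs"
  shows "leads X xs [V i, C c i, V i] [C (swap c) i]"
proof -
  note [simp] = i
  have "leads X xs [V i, C c i, V i] [V i, V i, C (swap c) i, V i, V i]"
    by (rule rewrite_braid[where k = 1, OF crossing_to_flanked[OF assms(1)]]) simp_all
  also have "xs \<turnstile> \<dots> \<approx> [C (swap c) i, V i, V i]"
    by (rule rewrite_braid[where k = 0, OF cancel_virtual]) simp_all
  also have "xs \<turnstile> \<dots> \<approx> [C (swap c) i]"
    by (rule rewrite_braid[where k = 1, OF cancel_virtual]) simp_all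
  finally show ?thesis .
qed

text \<open>
  Conjugation by the virtual triangle reverses the order of the three strands: it moves a
  crossing to the other position and exchanges the strands that enter it on the left and on the
  right, whence the flanking virtual crossings.
\<close>

lemma virtual_triangle_crossing:
  assumes ij: "adjacent (length xs) i j"
  shows "xs \<turnstile> [V i, V j, V i, C c j] \<approx> [V i, C c i, V i, V i, V j, V i]"
proof -
  note [simp] = adjacentD[OF ij] ij
  have "xs \<turnstile> [V i, V j, V i, C c j] \<approx> [V i, C c i, V j, V i]"
    by (rule rewrite_braid[where k = 1, OF detour]) simp_all
  also have "xs \<turnstile> \<dots> \<approx> [V i, C c i, V i, V i, V j, V i]"
    by (rule rewrite_braid[where k = 2, OF eqv_sym[OF cancel_virtual[of i]]]) simp_all
  finally show ?thesis .
qed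

lemma virtual_triangle_alternating:
  assumes ij: "adjacent (length xs) i j"
  shows "xs \<turnstile> [V i, V j, V i, C c j, C c' i, C c j] \<approx>
    [V i, C c i, V i, V j, C c' j, V j, V i, C c i, V i, V i, V j, V i]"
proof -
  note [simp] = adjacentD[OF ij] ij
  have "xs \<turnstile> [V i, V j, V i, C c j, C c' i, C c j] \<approx>
      [V i, C c i, V i, V i, V j, V i, C c' i, C c j]"
    by (rule rewrite_braid[where k = 0, OF virtual_triangle_crossing]) simp_all
  also have "xs \<turnstile> \<dots> \<approx> [V i, C c i, V i, V j, V i, V j, C c' i, C c j]"
    by (rule rewrite_braid[where k = 3, OF virtual_triangle]) simp_all
  also have "xs \<turnstile> \<dots> \<approx> [V i, C c i, V i, V j, C c' j, V j, V j, V i, V j, C c j]"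
    by (rule rewrite_braid[where k = 3, OF virtual_triangle_crossing]) simp_all
  also have "xs \<turnstile> \<dots> \<approx> [V i, C c i, V i, V j, C c' j, V j, V i, V j, V i, C c j]"
    by (rule rewrite_braid[where k = 6, OF virtual_triangle]) simp_all
  also have "xs \<turnstile> \<dots> \<approx>
      [V i, C c i, V i, V j, C c' j, V j, V i, C c i, V i, V i, V j, V i]"
    by (rule rewrite_braid[where k = 6, OF virtual_triangle_crossing]) simp_all
  finally show ?thesis .
qed

text \<open>
  Both kinds of replacement are needed: \<open>v c v\<close> becomes \<open>c'\<close> by turning, and \<open>v c' v\<close> becomes
  \<open>c\<close> by inserting a square directly.
\<close>

lemma adds_swap_if_adds:
  assumes "adds X c"
  shows "adds X (swap c)"
  unfolding adds_def swap_swap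
proof (intro allI impI)
  fix xs :: "direction list" and i j
  assume ij: "adjacent (length xs) i j"
  note [simp] = adjacentD[OF ij] ij
  let ?c = "swap c"
  have "xs \<turnstile> [V i, V j, V i] \<approx> [V i, V j, V i, V j, V i, V j, V j, V i, V j]"
    by (rule rewrite_braid[where k = 3, OF virtual_triangle_twice[of _ j i]]) simp_all
  also have "leads X xs \<dots> [V i, V j, V i, C c j, C ?c i, C c j, V j, V i, V j]"
    by (rule rewrite_braid[where k = 3, OF assms[unfolded adds_def, rule_format]]) simp_all
  also have "xs \<turnstile> \<dots> \<approx> [V i, V j, V i, C c j, C ?c i, C c j, V i, V j, V i]"
    by (rule rewrite_braid[where k = 6, OF virtual_triangle]) simp_all
  also have "xs \<turnstile> \<dots> \<approx> [V i, C c i, V i, V j, C ?c j, V j, V i, C c i, V i,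
      V i, V j, V i, V i, V j, V i]"
    by (rule rewrite_braid[where k = 0, OF virtual_triangle_alternating]) simp_all
  also have "xs \<turnstile> \<dots> \<approx> [V i, C c i, V i, V j, C ?c j, V j, V i, C c i, V i]"
    by (rule rewrite_braid[where k = 9, OF eqv_sym[OF virtual_triangle_twice]]) simp_all
  also have "leads X xs \<dots> [C ?c i, V j, C ?c j, V j, V i, C c i, V i]"
    by (rule rewrite_braid[where k = 0, OF flanked_to_crossing_swap[OF assms]]) simp_all
  also have "leads X xs \<dots> [C ?c i, C c j, V i, C c i, V i]"
    by (rule rewrite_braid[where k = 1, OF flanked_to_crossing[OF assms, of _ i j]]) simp_all
  also have "leads X xs \<dots> [C ?c i, C c j, C ?c i]"
    by (rule rewrite_braid[where k = 2, OF flanked_to_crossing_swap[OF assms]]) simp_all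
  finally show "leads X xs [V i, V j, V i] [C ?c i, C c j, C ?c i]" .
qed


section \<open>The four moves as insertions and removals of patterns\<close>

lemma adds_and_removes_both_signs:
  assumes "adds X c \<or> removes X c"
  shows "adds X c \<and> removes X c \<and> adds X (swap c) \<and> removes X (swap c)"
  using assms adds_swap_if_removes adds_swap_if_adds removes_swap_if_adds swap_swap by metis

definition alternating :: "branch \<Rightarrow> nat \<Rightarrow> nat \<Rightarrow> level list" where
  "alternating s i j = triangle i j (Real s) (Real (other s)) (Real s)"

text \<open>
  Every vertex is the initial vertex of one side and the final vertex of another. On both branches
  the condition then prescribes the same upper branch, so exactly one triple of crossings fulfils it.
\<close>

lemma alternating_sides:
  assumes "j = Suc i \<or> i = Suc j"
  shows "(\<forall>((x, s), (y, t)) \<in> counterclockwise_sides i j a b c. under x s \<and> over y t) \<longleftrightarrow>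
      a = Real Backslash \<and> b = Real Slash \<and> c = Real Backslash" (is ?under_over)
    and "(\<forall>((x, s), (y, t)) \<in> counterclockwise_sides i j a b c. over x s \<and> under y t) \<longleftrightarrow>
      a = Real Slash \<and> b = Real Backslash \<and> c = Real Slash" (is ?over_under)
proof -
  have over: "over c s \<longleftrightarrow> c = Real s" for c s
    by (cases c) auto
  have under: "under c s \<longleftrightarrow> c = Real (other s)" for c s
    by (cases c; cases s) (auto, (metis branch.exhaust)+)
  show ?under_over ?over_under
    using assms by (auto simp: counterclockwise_sides_def over under)
qed

lemma Delta_iff: "Delta l r \<longleftrightarrow> (\<exists>i j. (j = Suc i \<or> i = Suc j) \<and>
    l = alternating Backslash i j \<and> r = triangle i j Virtual Virtual Virtual)"
proof
  assume "Delta l r"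
  then show "\<exists>i j. (j = Suc i \<or> i = Suc j) \<and> l = alternating Backslash i j \<and>
      r = triangle i j Virtual Virtual Virtual"
  proof cases
    case (1 j i a b c)
    have "a = Real Backslash \<and> b = Real Slash \<and> c = Real Backslash"
      by (rule iffD1[OF alternating_sides(1)[OF 1(3)] 1(4)])
    with 1(1-3) show ?thesis
      by (intro exI[of _ i] exI[of _ j]) (simp add: alternating_def)
  qed
next
  assume "\<exists>i j. (j = Suc i \<or> i = Suc j) \<and> l = alternating Backslash i j \<and>
      r = triangle i j Virtual Virtual Virtual"
  then obtain i j where ij: "j = Suc i \<or> i = Suc j" and l: "l = alternating Backslash i j"
    and r: "r = triangle i j Virtual Virtual Virtual"
    by blast
  show "Delta l r"
    unfolding l r alternating_def other.simps
    by (rule Delta.intros[OF ij iffD2[OF alternating_sides(1)[OF ij]]]) simp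
qed

lemma Delta'_iff: "Delta' l r \<longleftrightarrow> (\<exists>i j. (j = Suc i \<or> i = Suc j) \<and>
    l = alternating Slash i j \<and> r = triangle i j Virtual Virtual Virtual)"
proof
  assume "Delta' l r"
  then show "\<exists>i j. (j = Suc i \<or> i = Suc j) \<and> l = alternating Slash i j \<and>
      r = triangle i j Virtual Virtual Virtual"
  proof cases
    case (1 j i a b c)
    have "a = Real Slash \<and> b = Real Backslash \<and> c = Real Slash"
      by (rule iffD1[OF alternating_sides(2)[OF 1(3)] 1(4)])
    with 1(1-3) show ?thesis
      by (intro exI[of _ i] exI[of _ j]) (simp add: alternating_def)
  qed
next
  assume "\<exists>i j. (j = Suc i \<or> i = Suc j) \<and> l = alternating Slash i j \<and>
      r = triangle i j Virtual Virtual Virtual"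
  then obtain i j where ij: "j = Suc i \<or> i = Suc j" and l: "l = alternating Slash i j"
    and r: "r = triangle i j Virtual Virtual Virtual"
    by blast
  show "Delta' l r"
    unfolding l r alternating_def other.simps
    by (rule Delta'.intros[OF ij iffD2[OF alternating_sides(2)[OF ij]]]) simp
qed

lemma Delta_alternating: "j = Suc i \<or> i = Suc j \<Longrightarrow>
    Delta (alternating Backslash i j) (triangle i j Virtual Virtual Virtual)"
  unfolding Delta_iff by (intro exI[of _ i] exI[of _ j]) simp

lemma Delta'_alternating: "j = Suc i \<or> i = Suc j \<Longrightarrow>
    Delta' (alternating Slash i j) (triangle i j Virtual Virtual Virtual)"
  unfolding Delta'_iff by (intro exI[of _ i] exI[of _ j]) simp

lemma shift_triangle: "shift k (triangle i j a b c) = triangle (k + i) (k + j) a b c"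
  by (simp add: triangle_def)

lemma move_rule_shift: "move_rule X l r \<Longrightarrow> move_rule X (shift k l) (shift k r)"
proof -
  have "\<exists>i j. (j = Suc i \<or> i = Suc j) \<and> shift k l = alternating s i j \<and>
      shift k r = triangle i j Virtual Virtual Virtual"
    if "\<exists>i j. (j = Suc i \<or> i = Suc j) \<and> l = alternating s i j \<and>
      r = triangle i j Virtual Virtual Virtual" for s l r
  proof -
    from that obtain i j where "j = Suc i \<or> i = Suc j" "l = alternating s i j"
      "r = triangle i j Virtual Virtual Virtual"
      by blast
    then show ?thesis
      by (intro exI[of _ "k + i"] exI[of _ "k + j"]) (auto simp: alternating_def shift_triangle)
  qed
  note shifted = this
  have "Delta (shift k l) (shift k r)" if "Delta l r" for l r
    using that unfolding Delta_iff by (rule shifted)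
  moreover have "Delta' (shift k l) (shift k r)" if "Delta' l r" for l r
    using that unfolding Delta'_iff by (rule shifted)
  ultimately show "move_rule X l r \<Longrightarrow> move_rule X (shift k l) (shift k r)"
    by (cases X) simp_all
qed

lemma run_triangle:
  assumes "adjacent (length xs) i j"
  shows "\<exists>ys. \<forall>a b c. run xs (triangle i j a b c) = Some ys"
proof -
  have "braid (length xs) (triangle i j Virtual Virtual Virtual)"
    using adjacentD[OF assms] by (simp add: triangle_def)
  then obtain ys where "run xs (triangle i j Virtual Virtual Virtual) = Some ys"
    using run_braid by blast
  then have "run xs (triangle i j a b c) = Some ys" for a b c
    by (simp only: triangle_def run.simps run_level.simps)
  then show ?thesis by blast
qed

lemma adjacent_if_run_triangle:
  assumes "run xs (triangle i j a b c) \<noteq> None" "j = Suc i \<or> i = Suc j"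
  shows "adjacent (length xs) i j"
proof -
  have i: "Suc i < length xs"
    by (rule ccontr) (use assms(1) in \<open>simp add: triangle_def\<close>)
  let ?ys = "take i xs @ [xs ! Suc i, xs ! i] @ drop (Suc (Suc i)) xs"
  have "length ?ys = length xs" and "run_level xs (i, Cross a) = Some ?ys"
    using i by simp_all
  moreover from this(2) have "run_level ?ys (j, Cross b) \<noteq> None"
    using assms(1) by (intro notI) (simp only: triangle_def run.simps option.case simp_thms)
  ultimately have "Suc j < length xs"
    by (metis run_level.simps(3))
  with i assms(2) show ?thesis
    by (simp add: adjacent_def)
qed

lemma leads_move:
  assumes "move_rule X l r" "run xs l = Some ys" "run xs r = Some ys"
  shows "leads X xs l r"
proof (rule locally_mono)
  show "locally (replacement (move_rule X)) xs l r"
    by (rule locally_replacement[of "move_rule X", OF assms(1) move_rule_shift assms(2,3)])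
  show "replacement (move_rule X) \<le> realized_by X"
  proof (rule predicate2I)
    fix D D'
    assume "replacement (move_rule X) D D'"
    then have "delta_move X D D'"
      unfolding delta_move_def by (rule local_moveI)
    then show "realized_by X D D'"
      unfolding realized_by_def by - (rule r_into_rtranclp, blast)
  qed
qed

lemma adds_and_removes: "adds X (Real s) \<and> removes X (Real s)"
proof -
  have adds: "adds X (Real t)"
    if "\<And>i j. j = Suc i \<or> i = Suc j \<Longrightarrow>
      move_rule X (triangle i j Virtual Virtual Virtual) (alternating t i j)" for t
    unfolding adds_def
  proof (intro allI impI)
    fix xs :: "direction list" and i j
    assume ij: "adjacent (length xs) i j"
    obtain ys where ys: "\<And>a b c. run xs (triangle i j a b c) = Some ys"
      using run_triangle[OF ij] by blast
    have "leads X xs (triangle i j Virtual Virtual Virtual) (alternating t i j)"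
    proof (rule leads_move)
      show "move_rule X (triangle i j Virtual Virtual Virtual) (alternating t i j)"
        using ij by (intro that) (simp add: adjacent_def)
      show "run xs (triangle i j Virtual Virtual Virtual) = Some ys" "run xs (alternating t i j) = Some ys"
        by (simp_all only: ys alternating_def)
    qed
    then show "leads X xs [V i, V j, V i] [C (Real t) i, C (swap (Real t)) j, C (Real t) i]"
      by (simp add: alternating_def triangle_def)
  qed
  have removes: "removes X (Real t)"
    if "\<And>i j. j = Suc i \<or> i = Suc j \<Longrightarrow>
      move_rule X (alternating t i j) (triangle i j Virtual Virtual Virtual)" for t
    unfolding removes_def
  proof (intro allI impI)
    fix xs :: "direction list" and i j
    assume ij: "adjacent (length xs) i j"
    obtain ys where ys: "\<And>a b c. run xs (triangle i j a b c) = Some ys"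
      using run_triangle[OF ij] by blast
    have "leads X xs (alternating t i j) (triangle i j Virtual Virtual Virtual)"
    proof (rule leads_move)
      show "move_rule X (alternating t i j) (triangle i j Virtual Virtual Virtual)"
        using ij by (intro that) (simp add: adjacent_def)
      show "run xs (alternating t i j) = Some ys" "run xs (triangle i j Virtual Virtual Virtual) = Some ys"
        by (simp_all only: ys alternating_def)
    qed
    then show "leads X xs [C (Real t) i, C (swap (Real t)) j, C (Real t) i] [V i, V j, V i]"
      by (simp add: alternating_def triangle_def)
  qed
  have "adds X (Real Slash) \<or> removes X (Real Slash) \<or>
      adds X (Real Backslash) \<or> removes X (Real Backslash)"
  proof (cases X)
    case rv_Delta
    then have "removes X (Real Backslash)"
      using removes[of Backslash] Delta_alternating by simp
    then show ?thesis by blast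
  next
    case vr_Delta
    then have "adds X (Real Backslash)"
      using adds[of Backslash] Delta_alternating by simp
    then show ?thesis by blast
  next
    case rv_Delta'
    then have "removes X (Real Slash)"
      using removes[of Slash] Delta'_alternating by simp
    then show ?thesis by blast
  next
    case vr_Delta'
    then have "adds X (Real Slash)"
      using adds[of Slash] Delta'_alternating by simp
    then show ?thesis by blast
  qed
  then have "\<forall>t. adds X (Real t) \<and> removes X (Real t)"
    using adds_and_removes_both_signs[of X "Real Slash"] adds_and_removes_both_signs[of X "Real Backslash"]
    unfolding swap.simps other.simps by (metis (full_types) branch.exhaust)
  then show ?thesis ..
qed

lemma move_rule_realized:
  assumes "move_rule Y l r" "run xs l \<noteq> None"
  shows "leads X xs l r"
proof -
  have "\<exists>s i j. (j = Suc i \<or> i = Suc j) \<and>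
    (l = alternating s i j \<and> r = triangle i j Virtual Virtual Virtual \<or>
     l = triangle i j Virtual Virtual Virtual \<and> r = alternating s i j)"
    using assms(1) by (cases Y; simp add: Delta_iff Delta'_iff; blast)
  then obtain s i j where ij: "j = Suc i \<or> i = Suc j" and
    lr: "l = alternating s i j \<and> r = triangle i j Virtual Virtual Virtual \<or>
     l = triangle i j Virtual Virtual Virtual \<and> r = alternating s i j"
    by blast
  have adj: "adjacent (length xs) i j"
    using lr assms(2) ij unfolding alternating_def by (metis adjacent_if_run_triangle)
  show ?thesis
    using lr
  proof (elim disjE conjE)
    assume "l = alternating s i j" "r = triangle i j Virtual Virtual Virtual"
    then show ?thesis
      using adds_and_removes[of X s] adj by (simp add: removes_def alternating_def triangle_def)
  next
    assume "l = triangle i j Virtual Virtual Virtual" "r = alternating s i j"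
    then show ?thesis
      using adds_and_removes[of X s] adj by (simp add: adds_def alternating_def triangle_def)
  qed
qed

theorem theorem4p4:
  fixes X Y :: move_type and D D' :: diagram
  assumes "X \<noteq> Y" and "delta_move Y D D'"
  shows "realized_by X D D'"
proof -
  obtain E E' where D: "planar_isotopic D E" and E: "replacement (move_rule Y) E E'"
    and D': "planar_isotopic E' D'"
    using assms(2) unfolding delta_move_def local_move_def by blast
  obtain u v l r where lr: "move_rule Y l r" and E_eq: "E = u @ l @ v" "E' = u @ r @ v"
    and "virtual_link_diagram E"
    using E unfolding replacement_def by blast
  then obtain xs where xs: "run [] u = Some xs" "run xs l \<noteq> None"
    by (auto simp: diagram_iff_run run_append bind_eq_Some_conv)
  have [simp]: "shift 0 w = w" for w
    by (induction w) auto
  note leads = move_rule_realized[OF lr xs(2), of X, unfolded locally_def, THEN spec[of _ "[]"],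
      THEN spec[of _ "[]"], THEN conjunct2, THEN spec[of _ u], THEN spec[of _ v]]
  have "realized_by X E E'"
    using leads xs(1) \<open>virtual_link_diagram E\<close> by (simp add: E_eq)
  moreover have "planar_isotopic \<le> realized_by X"
    unfolding realized_by_def by auto
  ultimately show ?thesis
    using D D' unfolding realized_by_def by (blast intro: rtranclp_trans)
qed

end
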